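(* Let $a,b,c\in\mathbb{T}\mathbb{P}^2$ be three points determining a transversal tropical triangle. Then: (1) the set of points of $\mathbb{T}\mathbb{P}^2$ tropically spanned by $a,b,c$ is exactly the solid hexagon $\mathcal{H}(abc)$; (2) the points $a,b,c$ are tropically independent; (3) the $3\times3$ matrix whose rows are (representatives of) the coordinates of $a,b,c$ is tropically regular.
   Context: The tropical semifield is $\mathbb{T}=\mathbb{R}\cup\{-\infty\}$ with $x\oplus y=\max\{x,y\}$, $x\odot y=x+y$. $\mathbb{T}\mathbb{P}^2$ is $\mathbb{T}^3\setminus\{(-\infty,-\infty,-\infty)\}$ modulo adding real multiples of $(1,1,1)$; classes are written $[x_1,x_2,x_3]$; a point is interior if all coordinates are real; for interior $u$, $-u:=[-u_1,-u_2,-u_3]$. A tropical line is a set $\{[x_1,x_2,x_3]:\max\{u_1+x_1,u_2+x_2,u_3+x_3\}\text{ attained at least twice}\}$ with $u_i\in\mathbb{R}$. Two points are transversal if exactly one tropical line passes through both; for transversal $p,q$ this line is denoted $pq$. Two tropical lines are transversal if they meet in exactly one point. Three points $a,b,c$ determine a transversal tropical triangle if they are distinct interior points, tropically non-collinear (no tropical line contains all three), pairwise transversal, and the lines $ab,bc,ca$ are pairwise transversal. For interior $a,b$, $a\otimes b:=[\max\{a_2+b_3,b_2+a_3\},\max\{a_1+b_3,b_1+a_3\},\max\{a_1+b_2,b_1+a_2\}]$; the point $-(a\otimes b)$ is the vertex of the line $ab$. Identify interior points of $\mathbb{T}\mathbb{P}^2$ with $\mathbb{R}^2$ via $[x,y,z]\mapsto(x-z,y-z)$;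 $\mathcal{H}(abc)$ is the classical convex hull in $\mathbb{R}^2$ of the six points $a,-(a\otimes b),b,-(b\otimes c),c,-(c\otimes a)$ (a convex hexagon with sides of slopes $\infty,0,1$). A point $u$ is tropically spanned by distinct interior points $u_1,\dots,u_s$ if $u=\lambda_1\odot u_1\oplus\cdots\oplus\lambda_s\odot u_s=\max\{\lambda_1+u_1,\dots,\lambda_s+u_s\}$ (coordinatewise, on representatives) for some $\lambda_j\in\mathbb{T}$ not all $-\infty$. The points $u_1,\dots,u_s$ are tropically independent if no $u_j$ is tropically spanned by the others. The tropical determinant of an $n\times n$ real matrix $A=(a_{ij})$ is $\max_{\sigma\in S_n}\{a_{1\sigma(1)}+\cdots+a_{n\sigma(n)}\}$; $A$ is tropically regular if this maximum is attained by exactly one permutation $\sigma$. *)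

theory Defs
  imports "HOL-Analysis.Analysis"
begin

(* The tropical semifield T is rendered as the extended reals different from \<infinity>;
   tropical addition is max and tropical multiplication is +. *)
definition T3 :: "(ereal ^ 3) set" where
  "T3 = {x. (\<forall>i. x $ i \<noteq> \<infinity>) \<and> (\<exists>i. x $ i \<noteq> - \<infinity>)}"

definition proj_eq :: "ereal ^ 3 \<Rightarrow> ereal ^ 3 \<Rightarrow> bool" where
  "proj_eq x y \<longleftrightarrow> x \<in> T3 \<and> y \<in> T3 \<and> (\<exists>t::real. \<forall>i. y $ i = ereal t + x $ i)"

lemma part_equivp_proj_eq: "part_equivp proj_eq"
proof (rule part_equivpI)
  show "\<exists>x. proj_eq x x"
    by (rule exI[of _ 0]) (auto simp: proj_eq_def T3_def intro!: exI[of _ 0])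
  show "symp proj_eq"
  proof (rule sympI)
    fix x y assume *: "proj_eq x y"
    then obtain t :: real where t: "\<forall>i. y $ i = ereal t + x $ i"
      by (auto simp: proj_eq_def)
    have "x $ i = ereal (- t) + y $ i" for i
      using t[rule_format, of i] by (cases "x $ i") auto
    with * show "proj_eq y x" by (auto simp: proj_eq_def)
  qed
  show "transp proj_eq"
  proof (rule transpI)
    fix x y z assume *: "proj_eq x y" "proj_eq y z"
    then obtain t :: real where "\<forall>i. y $ i = ereal t + x $ i"
      by (auto simp: proj_eq_def)
    moreover from * obtain s :: real where "\<forall>i. z $ i = ereal s + y $ i"
      by (auto simp: proj_eq_def)
    ultimately have "z $ i = ereal (s + t) + x $ i" for i
      by (cases "x $ i") (auto simp: add.assoc)
    with * show "proj_eq x z" by (auto simp: proj_eq_def)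
  qed
qed

quotient_type tp2 = "ereal ^ 3" / partial: proj_eq
  morphisms rep_tp2 abs_tp2
  by (rule part_equivp_proj_eq)

lift_definition is_interior :: "tp2 \<Rightarrow> bool" is "\<lambda>x. \<forall>i. x $ i \<noteq> - \<infinity>"
  by (auto simp: proj_eq_def)

lift_definition pt :: "real ^ 3 \<Rightarrow> tp2" is "\<lambda>r. \<chi> i. ereal (r $ i)"
  by (auto simp: proj_eq_def T3_def intro!: exI[of _ 0])

lift_definition on_line :: "real ^ 3 \<Rightarrow> tp2 \<Rightarrow> bool" is
  "\<lambda>u x. card {i. ereal (u $ i) + x $ i = (MAX j. ereal (u $ j) + x $ j)} \<ge> 2"
proof -
  fix u :: "real ^ 3" and x y assume "proj_eq x y"
  then obtain t :: real where t: "\<And>i. y $ i = ereal t + x $ i"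
    by (auto simp: proj_eq_def)
  have m: "mono (\<lambda>z::ereal. ereal t + z)"
    by (auto intro!: monoI add_left_mono)
  have s: "ereal (u $ i) + y $ i = ereal t + (ereal (u $ i) + x $ i)" for i
    by (simp add: t add.left_commute)
  have M: "(MAX j. ereal (u $ j) + y $ j) = ereal t + (MAX j. ereal (u $ j) + x $ j)"
    unfolding s
    using mono_Max_commute[OF m, of "range (\<lambda>j. ereal (u $ j) + x $ j)"]
    by (simp add: image_image)
  have "(ereal (u $ i) + y $ i = (MAX j. ereal (u $ j) + y $ j)) \<longleftrightarrow>
        (ereal (u $ i) + x $ i = (MAX j. ereal (u $ j) + x $ j))" for i
    unfolding M unfolding s by (simp add: ereal_add_cancel_left)
  then show "(2 \<le> card {i. ereal (u $ i) + x $ i = (MAX j. ereal (u $ j) + x $ j)}) =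
        (2 \<le> card {i. ereal (u $ i) + y $ i = (MAX j. ereal (u $ j) + y $ j)})"
    by simp
qed

definition tropical_lines :: "tp2 set set" where
  "tropical_lines = range (\<lambda>u. {p. on_line u p})"

definition transversal_points :: "tp2 \<Rightarrow> tp2 \<Rightarrow> bool" where
  "transversal_points p q \<longleftrightarrow> (\<exists>!L. L \<in> tropical_lines \<and> p \<in> L \<and> q \<in> L)"

definition line_through :: "tp2 \<Rightarrow> tp2 \<Rightarrow> tp2 set" where
  "line_through p q = (THE L. L \<in> tropical_lines \<and> p \<in> L \<and> q \<in> L)"

definition transversal_lines :: "tp2 set \<Rightarrow> tp2 set \<Rightarrow> bool" where
  "transversal_lines L M \<longleftrightarrow> (\<exists>!p. p \<in> L \<and> p \<in> M)"

definition tropically_collinear :: "tp2 set \<Rightarrow> bool" where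
  "tropically_collinear S \<longleftrightarrow> (\<exists>L\<in>tropical_lines. S \<subseteq> L)"

definition transversal_triangle :: "tp2 \<Rightarrow> tp2 \<Rightarrow> tp2 \<Rightarrow> bool" where
  "transversal_triangle a b c \<longleftrightarrow>
     distinct [a, b, c] \<and> is_interior a \<and> is_interior b \<and> is_interior c \<and>
     \<not> tropically_collinear {a, b, c} \<and>
     transversal_points a b \<and> transversal_points b c \<and> transversal_points c a \<and>
     transversal_lines (line_through a b) (line_through b c) \<and>
     transversal_lines (line_through b c) (line_through c a) \<and>
     transversal_lines (line_through c a) (line_through a b)"

(* Negation and the tropical cross product are only meaningful for interior points;
   the values elsewhere are arbitrary. *)
lift_definition tneg :: "tp2 \<Rightarrow> tp2" is
  "\<lambda>x. if \<forall>i. x $ i \<noteq> - \<infinity> then (\<chi> i. - (x $ i)) else 0"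
proof -
  fix x y assume *: "proj_eq x y"
  then obtain t :: real where t: "\<And>i. y $ i = ereal t + x $ i"
    by (auto simp: proj_eq_def)
  have inf: "x $ i \<noteq> \<infinity>" for i
    using * by (auto simp: proj_eq_def T3_def)
  show "proj_eq (if \<forall>i. x $ i \<noteq> - \<infinity> then (\<chi> i. - (x $ i)) else 0)
                (if \<forall>i. y $ i \<noteq> - \<infinity> then (\<chi> i. - (y $ i)) else 0)"
  proof (cases "\<forall>i. x $ i \<noteq> - \<infinity>")
    case True
    have "- (y $ i) = ereal (- t) + - (x $ i)" for i
      using inf[of i] True by (cases "x $ i") (auto simp: t)
    with True inf show ?thesis
      by (auto simp: proj_eq_def T3_def t ereal_uminus_eq_reorder)
  next
    case False
    then show ?thesis
      by (auto simp: proj_eq_def T3_def t intro!: exI[of _ 0])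
  qed
qed

lift_definition tcross :: "tp2 \<Rightarrow> tp2 \<Rightarrow> tp2" is
  "\<lambda>x y. if (\<forall>i. x $ i \<noteq> - \<infinity>) \<and> (\<forall>i. y $ i \<noteq> - \<infinity>)
     then vector [max (x $ 2 + y $ 3) (y $ 2 + x $ 3),
                  max (x $ 1 + y $ 3) (y $ 1 + x $ 3),
                  max (x $ 1 + y $ 2) (y $ 1 + x $ 2)]
     else 0"
proof -
  fix x x' y y' assume *: "proj_eq x x'" "proj_eq y y'"
  then obtain s t :: real
    where s: "\<And>i. x' $ i = ereal s + x $ i" and t: "\<And>i. y' $ i = ereal t + y $ i"
    by (auto simp: proj_eq_def)
  have inf: "x $ i \<noteq> \<infinity>" "y $ i \<noteq> \<infinity>" for i
    using * by (auto simp: proj_eq_def T3_def)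
  show "?thesis x x' y y'"
  proof (cases "(\<forall>i. x $ i \<noteq> - \<infinity>) \<and> (\<forall>i. y $ i \<noteq> - \<infinity>)")
    case True
    define r q where "r = (\<lambda>i. real_of_ereal (x $ i))" and "q = (\<lambda>i. real_of_ereal (y $ i))"
    have r: "x $ i = ereal (r i)" and q: "y $ i = ereal (q i)" for i
      using True inf[of i] by (auto simp: r_def q_def ereal_real)
    show ?thesis
      by (auto simp: proj_eq_def T3_def s t r q forall_3 max_def vector_3 algebra_simps
               intro!: exI[of _ "1 :: 3"] exI[of _ "s + t"])
  next
    case False
    then show ?thesis
      by (auto simp: proj_eq_def T3_def s t intro!: exI[of _ 0])
  qed
qed

(* The identification [x, y, z] |-> (x - z, y - z) of the interior points with the plane;
   real_of_ereal makes it total. *)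
lift_definition affine_coords :: "tp2 \<Rightarrow> real \<times> real" is
  "\<lambda>x. (real_of_ereal (x $ 1 - x $ 3), real_of_ereal (x $ 2 - x $ 3))"
proof -
  fix x y assume "proj_eq x y"
  then obtain t :: real where t: "\<And>i. y $ i = ereal t + x $ i"
    by (auto simp: proj_eq_def)
  have "y $ i - y $ j = x $ i - x $ j" for i j
    by (cases "x $ i"; cases "x $ j") (auto simp: t)
  then show "(real_of_ereal (x $ 1 - x $ 3), real_of_ereal (x $ 2 - x $ 3)) =
             (real_of_ereal (y $ 1 - y $ 3), real_of_ereal (y $ 2 - y $ 3))"
    by simp
qed

definition hexagon :: "tp2 \<Rightarrow> tp2 \<Rightarrow> tp2 \<Rightarrow> (real \<times> real) set" where
  "hexagon a b c = convex hull (affine_coords `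
     {a, tneg (tcross a b), b, tneg (tcross b c), c, tneg (tcross c a)})"

(* Finite families of distinct points are given as finite sets. The canonical representatives
   rep_tp2 p can be used without loss of generality, since a change of representatives
   is absorbed by the scalars l p. *)
definition tropically_spanned :: "tp2 set \<Rightarrow> tp2 \<Rightarrow> bool" where
  "tropically_spanned S u \<longleftrightarrow>
     (\<exists>l :: tp2 \<Rightarrow> ereal. (\<forall>p\<in>S. l p \<noteq> \<infinity>) \<and> (\<exists>p\<in>S. l p \<noteq> - \<infinity>) \<and>
        u = abs_tp2 (\<chi> i. MAX p\<in>S. l p + rep_tp2 p $ i))"

definition tropically_independent :: "tp2 set \<Rightarrow> bool" where
  "tropically_independent S \<longleftrightarrow> (\<forall>p\<in>S. \<not> tropically_spanned (S - {p}) p)"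

definition tropical_det :: "real ^ 'n ^ 'n \<Rightarrow> real" where
  "tropical_det A = (MAX \<sigma>\<in>{\<sigma>. \<sigma> permutes (UNIV :: 'n set)}. \<Sum>i\<in>UNIV. A $ i $ \<sigma> i)"

definition tropically_regular :: "real ^ 'n ^ 'n \<Rightarrow> bool" where
  "tropically_regular A \<longleftrightarrow>
     (\<exists>!\<sigma>. \<sigma> permutes (UNIV :: 'n set) \<and> (\<Sum>i\<in>UNIV. A $ i $ \<sigma> i) = tropical_det A)"

end

theory Submission
  imports Defs
begin

text \<open>
  Two interior points are transversal only if the three coordinates of their difference are
  distinct. If the \<open>i\<close>-th coordinate were the largest one both in \<open>b - a\<close> and in \<open>c - a\<close>, the lines
  \<open>ab\<close> and \<open>ac\<close> would share the ray from \<open>a\<close> in direction \<open>-e\<^sub>i\<close>. Excluding this at all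
  three points leaves, up to relabelling the points, one possible order: the coordinates of
  \<open>b - a\<close>, \<open>c - b\<close>, \<open>a - c\<close> decrease along \<open>1, 2, 3\<close>, \<open>2, 3, 1\<close> and \<open>3, 1, 2\<close>
  respectively. Then both the tropical span and the hexagon are cut out by bounding each difference
  of two coordinates by its extremes over \<open>a, b, c\<close>. Each point is the strict
  maximiser of one such difference, which gives independence, and the unique maximal permutation
  can be read off the order.
\<close>

section \<open>Interior points and their real representatives\<close>

text \<open>The quotient is partial, so evaluating a lifted operation at \<open>pt x\<close> needs
  this instance of reflexivity.\<close>

lemma proj_eq_ereal: "proj_eq (\<chi> i. ereal (x $ i)) (\<chi> i. ereal (x $ i))"
  by (auto simp: proj_eq_def T3_def intro!: exI[of _ 0])

lemma pt_eq_iff: "pt x = pt y \<longleftrightarrow> (\<exists>t. \<forall>i. y $ i = t + x $ i)"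
proof -
  have "pt x = pt y \<longleftrightarrow> proj_eq (\<chi> i. ereal (x $ i)) (\<chi> i. ereal (y $ i))"
    using Quotient_rel[OF Quotient_tp2] proj_eq_ereal by (auto simp: pt.abs_eq)
  also have "\<dots> \<longleftrightarrow> (\<exists>t. \<forall>i. y $ i = t + x $ i)"
    by (auto simp: proj_eq_def T3_def)
  finally show ?thesis .
qed

lemma interior_iff_pt: "is_interior p \<longleftrightarrow> (\<exists>x. p = pt x)"
proof
  show "is_interior p" if "\<exists>x. p = pt x"
    using that by (auto simp: pt.abs_eq is_interior.abs_eq proj_eq_ereal)
  assume *: "is_interior p"
  have T3: "rep_tp2 p \<in> T3"
    using Quotient_rep_reflp[OF Quotient_tp2, of p] by (simp add: proj_eq_def)
  have "rep_tp2 p = (\<chi> i. ereal ((\<chi> i. real_of_ereal (rep_tp2 p $ i)) $ i))"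
    using * T3 by (auto simp: vec_eq_iff is_interior.rep_eq T3_def ereal_real)
  then show "\<exists>x. p = pt x"
    by (metis Quotient_abs_rep[OF Quotient_tp2] pt.abs_eq)
qed

text \<open>The representative chosen by \<open>rep_tp2\<close> is unspecified; the shift
  \<open>t\<close> is all that is unknown about it.\<close>

lemma rep_pt: "\<exists>t. \<forall>i. rep_tp2 (pt x) $ i = ereal (t + x $ i)"
proof -
  have "proj_eq (\<chi> i. ereal (x $ i)) (rep_tp2 (pt x))"
    using rep_abs_rsp[OF Quotient3_tp2 proj_eq_ereal] by (simp add: pt.abs_eq)
  then show ?thesis by (auto simp: proj_eq_def)
qed

lemma affine_coords_pt: "affine_coords (pt x) = (x $ 1 - x $ 3, x $ 2 - x $ 3)"
  by (simp add: pt.abs_eq affine_coords.abs_eq proj_eq_ereal)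

lemma tneg_pt: "tneg (pt x) = pt (- x)"
  by (simp add: pt.abs_eq tneg.abs_eq proj_eq_ereal)

lemma tcross_pt:
  "tcross (pt x) (pt y) = pt (vector [max (x $ 2 + y $ 3) (y $ 2 + x $ 3),
     max (x $ 1 + y $ 3) (y $ 1 + x $ 3), max (x $ 1 + y $ 2) (y $ 1 + x $ 2)])"
  by (auto simp: pt.abs_eq tcross.abs_eq proj_eq_ereal vec_eq_iff forall_3 vector_3 max_def
      intro!: arg_cong[where f = abs_tp2])

lemma tcross_pt_commute: "tcross (pt x) (pt y) = tcross (pt y) (pt x)"
  by (simp add: tcross_pt max.commute)

section \<open>Tropical lines through interior points\<close>

lemma card_ge_2_iff:
  fixes A :: "'a :: finite set"
  shows "card A \<ge> 2 \<longleftrightarrow> (\<exists>i j. i \<noteq> j \<and> i \<in> A \<and> j \<in> A)"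
proof -
  have "card A \<le> 1 \<longleftrightarrow> (\<forall>i\<in>A. \<forall>j\<in>A. i = j)"
    using card_le_Suc0_iff_eq[of A] by simp
  then show ?thesis by (auto simp: not_less_eq_eq numeral_2_eq_2)
qed

lemma on_line_pt:
  "on_line u (pt x) \<longleftrightarrow>
     (\<exists>i j. i \<noteq> j \<and> u $ i + x $ i = u $ j + x $ j \<and> (\<forall>k. u $ k + x $ k \<le> u $ i + x $ i))"
proof -
  define v where "v k = u $ k + x $ k" for k
  have *: "ereal (v i) = (MAX j. ereal (v j)) \<longleftrightarrow> (\<forall>k. v k \<le> v i)" for i
  proof -
    have "(MAX j. ereal (v j)) = ereal (v i) \<longleftrightarrow>
        ereal (v i) \<in> range (\<lambda>j. ereal (v j)) \<and> (\<forall>w \<in> range (\<lambda>j. ereal (v j)). w \<le> ereal (v i))"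
      by (rule Max_eq_iff) auto
    then show ?thesis by auto
  qed
  have "on_line u (pt x) \<longleftrightarrow> card {i. ereal (v i) = (MAX j. ereal (v j))} \<ge> 2"
    by (simp add: pt.abs_eq on_line.abs_eq proj_eq_ereal v_def)
  also have "\<dots> \<longleftrightarrow> (\<exists>i j. i \<noteq> j \<and> v i = v j \<and> (\<forall>k. v k \<le> v i))"
    unfolding card_ge_2_iff mem_Collect_eq * by (metis antisym)
  finally show ?thesis by (simp add: v_def)
qed

text \<open>Allows arguments about three coordinates to start from any two of them, without
  splitting into numerals.\<close>

lemma third_index:
  assumes "i \<noteq> (j :: 3)"
  obtains k where "k \<noteq> i" "k \<noteq> j" "\<And>P. (\<forall>l. P l) \<longleftrightarrow> P i \<and> P j \<and> P k"
proof -
  have "\<exists>k. k \<noteq> i \<and> k \<noteq> j"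
    using forall_3[of "\<lambda>k. k = i \<or> k = j"] by auto
  then obtain k where k: "k \<noteq> i" "k \<noteq> j" by blast
  have "l = i \<or> l = j \<or> l = k" for l
    using k assms exhaust_3[of i] exhaust_3[of j] exhaust_3[of k] exhaust_3[of l] by auto
  then have "(\<forall>l. P l) \<longleftrightarrow> P i \<and> P j \<and> P k" for P
    by metis
  then show ?thesis using that k by blast
qed

text \<open>If coordinates \<open>i\<close> and \<open>j\<close> changed equally from
  \<open>x\<close> to \<open>y\<close>, one could make these two terms tie at both points and then
  lower the third coefficient freely, so the joining line would not be unique.\<close>

lemma transversal_points_pt_imp:
  assumes "transversal_points (pt x) (pt y)" and "i \<noteq> j"
  shows "y $ i - x $ i \<noteq> y $ j - x $ j"
proof
  assume eq: "y $ i - x $ i = y $ j - x $ j"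
  obtain k where k: "k \<noteq> i" "k \<noteq> j" and all_iff: "\<And>P. (\<forall>l. P l) \<longleftrightarrow> P i \<and> P j \<and> P k"
    using third_index[OF \<open>i \<noteq> j\<close>] by blast
  define u :: "real \<Rightarrow> real ^ 3" where "u M = (\<chi> l. if l = k then - M else - (x $ l))" for M
  have u: "u M $ i = - (x $ i)" "u M $ j = - (x $ j)" "u M $ k = - M" for M
    using k by (auto simp: u_def)
  have ex_iff: "(\<exists>l. P l) \<longleftrightarrow> P i \<or> P j \<or> P k" for P
    using all_iff[of "\<lambda>l. \<not> P l"] by blast
  \<comment> \<open>From this value on, the term at \<open>k\<close> stays below or equal to the
    tied terms at both points.\<close>
  define M where "M = max (x $ k) (y $ k - (y $ i - x $ i))"
  have on: "on_line (u N) (pt x) \<and> on_line (u N) (pt y)" if "N \<ge> M" for N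
    unfolding on_line_pt using that \<open>i \<noteq> j\<close> eq
    by (intro conjI exI[of _ i] exI[of _ j]) (auto simp: u M_def all_iff)
  have "{p. on_line (u M) p} = {p. on_line (u (M + 1)) p}"
    using assms(1) on[of M] on[of "M + 1"]
    by (auto simp: transversal_points_def tropical_lines_def)
  \<comment> \<open>The vertex of the second line tells the two lines apart.\<close>
  moreover have "on_line (u (M + 1)) (pt (- u (M + 1)))"
    unfolding on_line_pt using \<open>i \<noteq> j\<close> by auto
  moreover have "\<not> on_line (u M) (pt (- u (M + 1)))"
    unfolding on_line_pt ex_iff all_iff by (simp add: u)
  ultimately show False by blast
qed

section \<open>Orders of the coordinate differences\<close>

text \<open>For transversal points: \<open>x\<close> lies on the ray of the joining line that leaves
  its vertex in direction \<open>-e\<^sub>i\<close>.\<close>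

definition leads :: "real ^ 3 \<Rightarrow> real ^ 3 \<Rightarrow> 3 \<Rightarrow> bool" where
  "leads x y i \<longleftrightarrow> (\<forall>j. j \<noteq> i \<longrightarrow> y $ j - x $ j < y $ i - x $ i)"

text \<open>Invariant under shifting points and coordinates cyclically together, but under no
  relabelling of the points alone; hence the six cases below.\<close>

definition cyclically_ordered :: "real ^ 3 \<Rightarrow> real ^ 3 \<Rightarrow> real ^ 3 \<Rightarrow> bool" where
  "cyclically_ordered x y z \<longleftrightarrow>
     y $ 1 - x $ 1 > y $ 2 - x $ 2 \<and> y $ 2 - x $ 2 > y $ 3 - x $ 3 \<and>
     z $ 2 - y $ 2 > z $ 3 - y $ 3 \<and> z $ 3 - y $ 3 > z $ 1 - y $ 1 \<and>
     x $ 3 - z $ 3 > x $ 1 - z $ 1 \<and> x $ 1 - z $ 1 > x $ 2 - z $ 2"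

text \<open>The disjuncts correspond to the six possible orders of the coordinates of
  \<open>y - x\<close>. The differences around the triangle sum to zero, so no two coordinates
  compare the same way in all three. Together with the conditions on \<open>leads\<close>, this lets
  the order of \<open>y - x\<close> determine the other two.\<close>

lemma cyclically_ordered_cases:
  assumes "\<And>i j. i \<noteq> j \<Longrightarrow> y $ i - x $ i \<noteq> y $ j - x $ j"
   "\<And>i j. i \<noteq> j \<Longrightarrow> z $ i - y $ i \<noteq> z $ j - y $ j"
   "\<And>i j. i \<noteq> j \<Longrightarrow> x $ i - z $ i \<noteq> x $ j - z $ j"
   "\<And>i. \<not> (leads x y i \<and> leads x z i)"
   "\<And>i. \<not> (leads y z i \<and> leads y x i)"
   "\<And>i. \<not> (leads z x i \<and> leads z y i)"
  shows "cyclically_ordered x y z \<or> cyclically_ordered y z x \<or> cyclically_ordered z x y \<or>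
    cyclically_ordered y x z \<or> cyclically_ordered x z y \<or> cyclically_ordered z y x"
  using assms(1)[of 1 2] assms(1)[of 2 3] assms(1)[of 3 1]
    assms(2)[of 1 2] assms(2)[of 2 3] assms(2)[of 3 1]
    assms(3)[of 1 2] assms(3)[of 2 3] assms(3)[of 3 1]
    assms(4)[of 1] assms(4)[of 2] assms(4)[of 3]
    assms(5)[of 1] assms(5)[of 2] assms(5)[of 3]
    assms(6)[of 1] assms(6)[of 2] assms(6)[of 3]
  unfolding cyclically_ordered_def leads_def forall_3 by simp (smt (verit))

section \<open>The hexagon as a system of inequalities\<close>

text \<open>The corners are listed counterclockwise, and each hypothesis says that one edge has
  nonnegative length. The region is convex, which bounds the hull; conversely, every horizontal
  slice of the region has its ends on edges of the hexagon.\<close>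

lemma hexagon_eq:
  fixes X1 X2 Y1 Y2 D1 D2 :: real
  assumes "D1 \<le> X1 - Y1" "X1 - Y1 \<le> D2" "Y1 \<le> X2 - D2" "X2 - D2 \<le> Y2" "X1 \<le> Y2 + D1" "Y2 + D1 \<le> X2"
  shows "convex hull {(X1, Y1), (Y1 + D2, Y1), (X2, X2 - D2), (X2, Y2), (Y2 + D1, Y2), (X1, X1 - D1)} =
    {(x, y). X1 \<le> x \<and> x \<le> X2 \<and> Y1 \<le> y \<and> y \<le> Y2 \<and> D1 \<le> x - y \<and> x - y \<le> D2}" (is "?H = ?R")
proof
  have "?R = ({X1..X2} \<times> {Y1..Y2}) \<inter> (\<lambda>(x, y). x - y) -` {D1..D2}" by auto
  moreover have "convex ((\<lambda>(x, y). x - y :: real) -` {D1..D2})"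
    by (rule convex_linear_vimage) (auto simp: linear_iff algebra_simps)
  ultimately have "convex ?R" by (auto intro!: convex_Int convex_Times)
  then show "?H \<subseteq> ?R" using assms by (intro hull_minimal) auto
  have seg: "p + t *\<^sub>R (q - p) \<in> ?H" if "p \<in> ?H" "q \<in> ?H" "0 \<le> t" "t \<le> 1" for p q t
    using convexD_alt[OF convex_convex_hull that] by (simp add: algebra_simps)
  have param: "\<exists>t. 0 \<le> t \<and> t \<le> 1 \<and> x = x1 + t * (x2 - x1)" if "x1 \<le> x" "x \<le> x2" for x1 x x2 :: real
  proof (cases "x1 = x2")
    case False
    then show ?thesis using that by (intro exI[of _ "(x - x1) / (x2 - x1)"]) (auto simp: field_simps)
  qed (use that in auto)
  have hor: "(x, y) \<in> ?H" if "(x1, y) \<in> ?H" "(x2, y) \<in> ?H" "x1 \<le> x" "x \<le> x2" for x1 x2 x y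
    using param[OF that(3,4)] seg[OF that(1,2)] by auto
  have ver: "(x, y) \<in> ?H" if "(x, y1) \<in> ?H" "(x, y2) \<in> ?H" "y1 \<le> y" "y \<le> y2" for y1 y2 x y
    using param[OF that(3,4)] seg[OF that(1,2)] by auto
  have dia: "(y + d, y) \<in> ?H" if y: "(y1 + d, y1) \<in> ?H" "(y2 + d, y2) \<in> ?H" "y1 \<le> y" "y \<le> y2" for y1 y2 d y
  proof -
    obtain t where t: "0 \<le> t" "t \<le> 1" "y = y1 + t * (y2 - y1)" using param[OF y(3,4)] by blast
    then show ?thesis using seg[OF y(1,2) t(1,2)] by (simp add: add_ac)
  qed
  have V: "(X1, Y1) \<in> ?H" "(Y1 + D2, Y1) \<in> ?H" "(X2, X2 - D2) \<in> ?H" "(X2, Y2) \<in> ?H"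
    "(Y2 + D1, Y2) \<in> ?H" "(X1, X1 - D1) \<in> ?H"
    by (auto intro: hull_inc)
  show "?R \<subseteq> ?H"
  proof clarify
    fix x y assume xy: "X1 \<le> x" "x \<le> X2" "Y1 \<le> y" "y \<le> Y2" "D1 \<le> x - y" "x - y \<le> D2"
    \<comment> \<open>The left end of the slice is on the vertical edge at \<open>X1\<close> or on
      the diagonal edge \<open>x - y = D1\<close>.\<close>
    have l: "(max X1 (y + D1), y) \<in> ?H"
      using ver[OF V(1,6), of y] dia[of "X1 - D1" D1 Y2 y] V(5,6) xy by (auto simp: max_def)
    have r: "(min X2 (y + D2), y) \<in> ?H"
      using ver[OF V(3,4), of y] dia[of Y1 D2 "X2 - D2" y] V(2,3) xy by (auto simp: min_def)
    show "(x, y) \<in> ?H" by (rule hor[OF l r]) (use xy in auto)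
  qed
qed

section \<open>Tropical regularity\<close>

text \<open>A permutation of three indices is determined by its values, so comparing distinct
  triples suffices.\<close>

lemma tropically_regular_3I:
  fixes A :: "real ^ 3 ^ 3"
  assumes dist: "distinct [i, j, k]"
    and less: "\<And>i' j' k'. distinct [i', j', k'] \<Longrightarrow> (i', j', k') \<noteq> (i, j, k) \<Longrightarrow>
      A $ 1 $ i' + A $ 2 $ j' + A $ 3 $ k' < A $ 1 $ i + A $ 2 $ j + A $ 3 $ k"
  shows "tropically_regular A"
proof -
  define \<tau> :: "3 \<Rightarrow> 3" where "\<tau> l = (if l = 1 then i else if l = 2 then j else k)" for l
  have \<tau>: "\<tau> 1 = i" "\<tau> 2 = j" "\<tau> 3 = k" by (auto simp: \<tau>_def)
  have "inj \<tau>"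
    using dist unfolding inj_def forall_3 \<tau> by auto
  then have perm: "\<tau> permutes UNIV"
    by (intro bij_imp_permutes bijI finite_UNIV_inj_surj) auto
  have lt: "(\<Sum>l\<in>UNIV. A $ l $ \<sigma> l) < (\<Sum>l\<in>UNIV. A $ l $ \<tau> l)" if "\<sigma> permutes UNIV" "\<sigma> \<noteq> \<tau>" for \<sigma>
  proof -
    have "distinct [\<sigma> 1, \<sigma> 2, \<sigma> 3]"
      using permutes_inj[OF that(1)] by (auto simp: inj_eq)
    moreover have "(\<sigma> 1, \<sigma> 2, \<sigma> 3) \<noteq> (i, j, k)"
      using that(2) \<tau> by (auto simp: fun_eq_iff forall_3)
    ultimately show ?thesis using less by (simp add: sum_3 \<tau>)
  qed
  have det: "tropical_det A = (\<Sum>l\<in>UNIV. A $ l $ \<tau> l)"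
    unfolding tropical_det_def using perm lt
    by (intro Max_eqI) (force simp: finite_permutations)+
  show ?thesis
    unfolding tropically_regular_def det using perm lt by (intro ex1I[of _ \<tau>]) force+
qed

text \<open>Compared with either other point, \<open>x\<close> gains most in coordinate 3,
  \<open>y\<close> in 1 and \<open>z\<close> in 2. This matching therefore beats every other
  one.\<close>

lemma cyclically_ordered_less:
  assumes "cyclically_ordered x y z" "distinct [i, j, k]" "(i, j, k) \<noteq> (3, 1, 2)"
  shows "x $ i + y $ j + z $ k < x $ 3 + y $ 1 + z $ 2"
  using assms exhaust_3[of i] exhaust_3[of j] exhaust_3[of k]
  unfolding cyclically_ordered_def by (elim disjE) auto

lemma cyclically_ordered_regular:
  assumes "cyclically_ordered x y z \<or> cyclically_ordered y z x \<or> cyclically_ordered z x y \<or>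
    cyclically_ordered y x z \<or> cyclically_ordered x z y \<or> cyclically_ordered z y x"
  shows "tropically_regular (vector [x, y, z] :: real ^ 3 ^ 3)"
proof -
  have regularI: "tropically_regular (vector [x, y, z] :: real ^ 3 ^ 3)"
    if "distinct [i, j, k]"
      "\<And>i' j' k'. distinct [i', j', k'] \<Longrightarrow> (i', j', k') \<noteq> (i, j, k) \<Longrightarrow>
        x $ i' + y $ j' + z $ k' < x $ i + y $ j + z $ k" for i j k
    by (rule tropically_regular_3I[OF that(1)]) (use that(2) in \<open>simp add: vector_3\<close>)
  from assms show ?thesis
  proof (elim disjE)
    assume *: "cyclically_ordered x y z"
    show ?thesis by (rule regularI[of 3 1 2], simp) (rule cyclically_ordered_less[OF *])
  next
    assume *: "cyclically_ordered y z x"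
    \<comment> \<open>The rows stay in place while the points are relabelled: the winning triple is
      \<open>(3, 1, 2)\<close> moved to the matching rows. The other cases do the same.\<close>
    have less: "x $ i + y $ j + z $ k < x $ 2 + y $ 3 + z $ 1"
      if ijk: "distinct [i, j, k]" "(i, j, k) \<noteq> (2, 3, 1)" for i j k
    proof -
      have "distinct [j, k, i]" "(j, k, i) \<noteq> (3, 1, 2)"
        using ijk by auto
      from cyclically_ordered_less[OF * this] show ?thesis by simp
    qed
    show ?thesis by (rule regularI[of 2 3 1], simp) (rule less)
  next
    assume *: "cyclically_ordered z x y"
    have less: "x $ i + y $ j + z $ k < x $ 1 + y $ 2 + z $ 3"
      if ijk: "distinct [i, j, k]" "(i, j, k) \<noteq> (1, 2, 3)" for i j k
    proof -
      have "distinct [k, i, j]" "(k, i, j) \<noteq> (3, 1, 2)"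
        using ijk by auto
      from cyclically_ordered_less[OF * this] show ?thesis by simp
    qed
    show ?thesis by (rule regularI[of 1 2 3], simp) (rule less)
  next
    assume *: "cyclically_ordered y x z"
    have less: "x $ i + y $ j + z $ k < x $ 1 + y $ 3 + z $ 2"
      if ijk: "distinct [i, j, k]" "(i, j, k) \<noteq> (1, 3, 2)" for i j k
    proof -
      have "distinct [j, i, k]" "(j, i, k) \<noteq> (3, 1, 2)"
        using ijk by auto
      from cyclically_ordered_less[OF * this] show ?thesis by simp
    qed
    show ?thesis by (rule regularI[of 1 3 2], simp) (rule less)
  next
    assume *: "cyclically_ordered x z y"
    have less: "x $ i + y $ j + z $ k < x $ 3 + y $ 2 + z $ 1"
      if ijk: "distinct [i, j, k]" "(i, j, k) \<noteq> (3, 2, 1)" for i j k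
    proof -
      have "distinct [i, k, j]" "(i, k, j) \<noteq> (3, 1, 2)"
        using ijk by auto
      from cyclically_ordered_less[OF * this] show ?thesis by simp
    qed
    show ?thesis by (rule regularI[of 3 2 1], simp) (rule less)
  next
    assume *: "cyclically_ordered z y x"
    have less: "x $ i + y $ j + z $ k < x $ 2 + y $ 1 + z $ 3"
      if ijk: "distinct [i, j, k]" "(i, j, k) \<noteq> (2, 1, 3)" for i j k
    proof -
      have "distinct [k, j, i]" "(k, j, i) \<noteq> (3, 1, 2)"
        using ijk by auto
      from cyclically_ordered_less[OF * this] show ?thesis by simp
    qed
    show ?thesis by (rule regularI[of 2 1 3], simp) (rule less)
  qed
qed

section \<open>Rays shared by two sides of a triangle\<close>

lemma line_through_commute: "line_through p q = line_through q p"
  unfolding line_through_def by (rule arg_cong[where f = The]) auto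

lemma transversal_lines_commute: "transversal_lines L M \<longleftrightarrow> transversal_lines M L"
  unfolding transversal_lines_def by (simp add: conj_commute)

lemma line_through_eqI:
  assumes "transversal_points p q" "on_line u p" "on_line u q"
  shows "line_through p q = {r. on_line u r}"
  using assms unfolding line_through_def transversal_points_def
  by (intro the1_equality) (auto simp: tropical_lines_def)

text \<open>The vertex of the line is \<open>x\<close> plus a positive multiple of \<open>e\<^sub>i\<close>, so the ray from \<open>x\<close>
  in direction \<open>-e\<^sub>i\<close> stays on the line.\<close>
lemma leads_line:
  assumes "leads x y i" "transversal_points (pt x) (pt y)" "t \<ge> 0"
  shows "pt (\<chi> j. x $ j - (if j = i then t else 0)) \<in> line_through (pt x) (pt y)"
proof -
  have "\<exists>j0. j0 \<noteq> i"
    using forall_3[of "\<lambda>k. k = i"] by auto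
  then obtain j0 where "j0 \<noteq> i" by blast
  then obtain k0 where "k0 \<noteq> i" "k0 \<noteq> j0" "\<And>P. (\<forall>l. P l) \<longleftrightarrow> P i \<and> P j0 \<and> P k0"
    using third_index by metis
  with \<open>j0 \<noteq> i\<close> obtain j k where jk: "j \<noteq> i" "k \<noteq> i" "k \<noteq> j" "y $ k - x $ k \<le> y $ j - x $ j"
    and all_iff: "\<And>P. (\<forall>l. P l) \<longleftrightarrow> P i \<and> P j \<and> P k"
    by (metis linear)
  have i: "y $ j - x $ j < y $ i - x $ i"
    using assms(1) jk by (auto simp: leads_def)
  \<comment> \<open>The vertex \<open>- u\<close> agrees with \<open>x\<close> outside
    \<open>i\<close>, and its coordinate \<open>i\<close> makes the terms \<open>i\<close> and
    \<open>j\<close> tie at \<open>y\<close>. They dominate there because \<open>j\<close> was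
    chosen as the second largest difference.\<close>
  define u :: "real ^ 3" where "u = (\<chi> l. if l = i then (y $ j - x $ j) - y $ i else - (x $ l))"
  have u: "u $ i = (y $ j - x $ j) - y $ i" "u $ j = - (x $ j)" "u $ k = - (x $ k)"
    using jk by (auto simp: u_def)
  have on: "on_line u (pt (\<chi> l. x $ l - (if l = i then t else 0)))" if "t \<ge> 0" for t
    unfolding on_line_pt using jk i that by (intro exI[of _ j] exI[of _ k]) (auto simp: u all_iff)
  have "on_line u (pt x)" using on[of 0] by simp
  moreover have "on_line u (pt y)"
    unfolding on_line_pt using jk i by (intro exI[of _ i] exI[of _ j]) (auto simp: u all_iff)
  ultimately show ?thesis
    using line_through_eqI[OF assms(2)] on[OF assms(3)] by auto
qed

text \<open>Both lines would contain the ray from \<open>x\<close>, and its points for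
  \<open>t = 0\<close> and \<open>t = 1\<close> are already two intersections.\<close>

lemma not_both_leads:
  assumes "transversal_points (pt x) (pt y)" "transversal_points (pt x) (pt z)"
    and "transversal_lines (line_through (pt x) (pt y)) (line_through (pt x) (pt z))"
  shows "\<not> (leads x y i \<and> leads x z i)"
proof
  assume *: "leads x y i \<and> leads x z i"
  have "pt (\<chi> j. x $ j - (if j = i then 0 else 0)) = pt (\<chi> j. x $ j - (if j = i then 1 else 0))"
    using assms(3) leads_line[of x y i 0] leads_line[of x y i 1] leads_line[of x z i 0]
      leads_line[of x z i 1] * assms(1,2) unfolding transversal_lines_def by auto
  then obtain t where t: "x $ j - (if j = i then 1 else 0) = t + x $ j" for j
    by (auto simp: pt_eq_iff)
  obtain j where "j \<noteq> i" using exhaust_3[of i] by (metis one_neq_zero)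
  with t[of i] t[of j] show False by simp
qed

lemma transversal_points_commute: "transversal_points p q \<longleftrightarrow> transversal_points q p"
  unfolding transversal_points_def by (simp add: conj_commute)

lemma transversal_triangle_cyclically_ordered:
  assumes "transversal_triangle (pt x) (pt y) (pt z)"
  shows "cyclically_ordered x y z \<or> cyclically_ordered y z x \<or> cyclically_ordered z x y \<or>
    cyclically_ordered y x z \<or> cyclically_ordered x z y \<or> cyclically_ordered z y x"
proof (rule cyclically_ordered_cases)
  have T: "transversal_points (pt x) (pt y)" "transversal_points (pt y) (pt z)"
    "transversal_points (pt z) (pt x)"
    and L: "transversal_lines (line_through (pt x) (pt y)) (line_through (pt y) (pt z))"
    "transversal_lines (line_through (pt y) (pt z)) (line_through (pt z) (pt x))"
    "transversal_lines (line_through (pt z) (pt x)) (line_through (pt x) (pt y))"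
    using assms by (auto simp: transversal_triangle_def)
  show "y $ i - x $ i \<noteq> y $ j - x $ j" "z $ i - y $ i \<noteq> z $ j - y $ j"
    "x $ i - z $ i \<noteq> x $ j - z $ j" if "i \<noteq> j" for i j
    using transversal_points_pt_imp that T by blast+
  show "\<not> (leads x y i \<and> leads x z i)" "\<not> (leads y z i \<and> leads y x i)"
    "\<not> (leads z x i \<and> leads z y i)" for i
    using T L not_both_leads
    by (metis line_through_commute transversal_lines_commute transversal_points_commute)+
qed

section \<open>Tropical span and independence\<close>

text \<open>A term attaining the maximum in coordinate \<open>i\<close> is a lower bound in
  coordinate \<open>j\<close>, so the difference of the two coordinates cannot exceed its value at
  that generator.\<close>

lemma tropically_spannedD:
  assumes "tropically_spanned S u" "finite S" "\<And>p. p \<in> S \<Longrightarrow> is_interior p"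
  obtains r where "u = pt r"
    "\<And>i j B. (\<And>x. pt x \<in> S \<Longrightarrow> x $ i - x $ j \<le> B) \<Longrightarrow> r $ i - r $ j \<le> B"
proof -
  obtain l where l: "\<And>p. p \<in> S \<Longrightarrow> l p \<noteq> \<infinity>" "\<exists>p\<in>S. l p \<noteq> - \<infinity>"
    and u: "u = abs_tp2 (\<chi> i. MAX p\<in>S. l p + rep_tp2 p $ i)"
    using assms(1) unfolding tropically_spanned_def by blast
  define m where "m i = (MAX p\<in>S. l p + rep_tp2 p $ i)" for i
  have S: "S \<noteq> {}" using l(2) by blast
  have rep: "\<exists>x. p = pt x \<and> (\<forall>i. rep_tp2 p $ i = ereal (x $ i))" if "p \<in> S" for p
  proof -
    from assms(3)[OF that] obtain x where x: "p = pt x" by (auto simp: interior_iff_pt)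
    obtain t where t: "\<forall>i. rep_tp2 (pt x) $ i = ereal (t + x $ i)" using rep_pt by blast
    have "p = pt (\<chi> i. t + x $ i)" by (auto simp: x pt_eq_iff)
    with t x show ?thesis by (intro exI[of _ "\<chi> i. t + x $ i"]) auto
  qed
  have m_in: "m i \<in> (\<lambda>p. l p + rep_tp2 p $ i) ` S" for i
    unfolding m_def using assms(2) S by (intro Max_in) auto
  have m_ge: "l p + rep_tp2 p $ i \<le> m i" if "p \<in> S" for p i
    unfolding m_def using assms(2) that by (intro Max_ge) auto
  have m_fin: "m i \<noteq> \<infinity>" for i
    using m_in[of i] l(1) rep by fastforce
  have m_nmin: "m i \<noteq> - \<infinity>" for i
  proof -
    obtain p where p: "p \<in> S" "l p \<noteq> - \<infinity>" using l(2) by blast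
    with rep obtain x where "rep_tp2 p $ i = ereal (x $ i)" by blast
    then show ?thesis using m_ge[OF p(1), of i] p(2) by (cases "l p") auto
  qed
  have r: "m i = ereal (real_of_ereal (m i))" for i
    using m_fin[of i] m_nmin[of i] by (cases "m i") auto
  define r where "r i = real_of_ereal (m i)" for i
  note r = r[folded r_def]
  show ?thesis
  proof (rule that[of "\<chi> i. r i"])
    show "u = pt (\<chi> i. r i)"
      by (simp add: u pt.abs_eq m_def[symmetric] r)
    fix i j B assume B: "\<And>x. pt x \<in> S \<Longrightarrow> x $ i - x $ j \<le> B"
    obtain p where p: "p \<in> S" "m i = l p + rep_tp2 p $ i" using m_in[of i] by blast
    obtain x where x: "p = pt x" "\<And>i. rep_tp2 p $ i = ereal (x $ i)" using rep[OF p(1)] by blast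
    have "x $ i - x $ j \<le> B" using B p(1) x(1) by blast
    then show "(\<chi> i. r i) $ i - (\<chi> i. r i) $ j \<le> B"
      using m_ge[OF p(1), of j] p(2) by (cases "l p") (auto simp: x(2) r)
  qed
qed

text \<open>Residuation: the witness scales each \<open>p\<close> as far as \<open>l + p \<le> r\<close> allows.\<close>
lemma tropically_spannedI:
  assumes "finite S" "\<And>p. p \<in> S \<Longrightarrow> is_interior p"
    and ex: "\<And>i. \<exists>x. pt x \<in> S \<and> (\<forall>j. r $ i - x $ i \<le> r $ j - x $ j)"
  shows "tropically_spanned S (pt r)"
proof -
  define l where "l p = Min (range (\<lambda>i. r $ i - real_of_ereal (rep_tp2 p $ i)))" for p
  have rep: "\<exists>t. \<forall>i. rep_tp2 (pt x) $ i = ereal (t + x $ i)" for x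
    by (rule rep_pt)
  have le: "l p \<le> r $ i - real_of_ereal (rep_tp2 p $ i)" for p i
    unfolding l_def by (intro Min_le) auto
  have rep_real: "rep_tp2 p $ i = ereal (real_of_ereal (rep_tp2 p $ i))" if "p \<in> S" for p i
    using assms(2)[OF that] rep by (auto simp: interior_iff_pt) (metis real_of_ereal.simps(1))
  have MAX: "(MAX p\<in>S. ereal (l p) + rep_tp2 p $ i) = ereal (r $ i)" for i
  proof (rule Max_eqI)
    show "finite ((\<lambda>p. ereal (l p) + rep_tp2 p $ i) ` S)" using assms(1) by simp
    fix v assume "v \<in> (\<lambda>p. ereal (l p) + rep_tp2 p $ i) ` S"
    then obtain p where p: "p \<in> S" "v = ereal (l p) + rep_tp2 p $ i" by blast
    show "v \<le> ereal (r $ i)"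
      unfolding p(2) by (subst rep_real[OF p(1)]) (use le[of p i] in simp)
  next
    \<comment> \<open>This generator has its smallest slack in coordinate \<open>i\<close>, so after
      scaling it meets \<open>r\<close> there.\<close>
    obtain x where x: "pt x \<in> S" "\<And>j. r $ i - x $ i \<le> r $ j - x $ j" using ex by blast
    obtain t where t: "\<And>i. rep_tp2 (pt x) $ i = ereal (t + x $ i)" using rep by blast
    have "l (pt x) = r $ i - (t + x $ i)"
      unfolding l_def t using x(2) by (intro Min_eqI) (auto simp: algebra_simps)
    then show "ereal (r $ i) \<in> (\<lambda>p. ereal (l p) + rep_tp2 p $ i) ` S"
      using x(1) t by (intro image_eqI[of _ _ "pt x"]) auto
  qed
  have "S \<noteq> {}" using ex by blast
  then show ?thesis
    unfolding tropically_spanned_def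
    by (intro exI[of _ "\<lambda>p. ereal (l p)"]) (auto simp: MAX pt.abs_eq)
qed

lemma pt_eq_imp_diff_eq:
  assumes "pt x = pt y"
  shows "x $ i - x $ j = y $ i - y $ j"
  using assms by (auto simp: pt_eq_iff)

text \<open>The differences that single out \<open>x\<close>, \<open>y\<close>, \<open>z\<close> are
  those of coordinates 3 and 1, 1 and 2, 2 and 3; a combination of the other two points cannot reach
  them.\<close>

lemma cyclically_ordered_independent:
  assumes "cyclically_ordered x y z"
  shows "tropically_independent {pt x, pt y, pt z}"
proof -
  have not: "\<not> tropically_spanned (S - {pt w}) (pt w)"
    if S: "finite S" "\<And>p. p \<in> S \<Longrightarrow> is_interior p"
      and less: "\<And>v. pt v \<in> S \<Longrightarrow> pt v \<noteq> pt w \<Longrightarrow> v $ i - v $ j \<le> B" and gt: "B < w $ i - w $ j"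
    for S and w :: "real ^ 3" and i j B
  proof
    assume "tropically_spanned (S - {pt w}) (pt w)"
    then obtain r where r: "pt w = pt r"
      "\<And>i j B. (\<And>x. pt x \<in> S - {pt w} \<Longrightarrow> x $ i - x $ j \<le> B) \<Longrightarrow> r $ i - r $ j \<le> B"
      by (rule tropically_spannedD) (use S in blast)+
    obtain t where "\<And>i. r $ i = t + w $ i" using r(1) by (auto simp: pt_eq_iff)
    moreover have "r $ i - r $ j \<le> B" using r(2) less by blast
    ultimately show False using gt by simp
  qed
  let ?S = "{pt x, pt y, pt z}"
  have S: "finite ?S" "\<And>p. p \<in> ?S \<Longrightarrow> is_interior p" by (auto simp: interior_iff_pt)
  have "\<not> tropically_spanned (?S - {pt x}) (pt x)"
    by (rule not[OF S, where i = 3 and j = 1 and B = "max (y $ 3 - y $ 1) (z $ 3 - z $ 1)"])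
      (use assms in \<open>auto simp: cyclically_ordered_def pt_eq_iff\<close>)
  moreover have "\<not> tropically_spanned (?S - {pt y}) (pt y)"
    by (rule not[OF S, where i = 1 and j = 2 and B = "max (x $ 1 - x $ 2) (z $ 1 - z $ 2)"])
      (use assms in \<open>auto simp: cyclically_ordered_def pt_eq_iff\<close>)
  moreover have "\<not> tropically_spanned (?S - {pt z}) (pt z)"
    by (rule not[OF S, where i = 2 and j = 3 and B = "max (x $ 2 - x $ 3) (y $ 2 - y $ 3)"])
      (use assms in \<open>auto simp: cyclically_ordered_def pt_eq_iff\<close>)
  ultimately show ?thesis unfolding tropically_independent_def by blast
qed

text \<open>The bounds are the extremes of the differences over the three points. Conversely, they
  are the six inequalities residuation requires when \<open>y\<close>, \<open>z\<close>,
  \<open>x\<close> supply coordinates 1, 2, 3, the matching that also gives regularity.\<close>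

lemma cyclically_ordered_spanned_iff:
  assumes "cyclically_ordered x y z"
  shows "tropically_spanned {pt x, pt y, pt z} (pt r) \<longleftrightarrow>
    r $ 1 - r $ 2 \<in> {z $ 1 - z $ 2..y $ 1 - y $ 2} \<and> r $ 2 - r $ 3 \<in> {x $ 2 - x $ 3..z $ 2 - z $ 3} \<and>
    r $ 1 - r $ 3 \<in> {x $ 1 - x $ 3..y $ 1 - y $ 3}" (is "tropically_spanned ?S _ \<longleftrightarrow> ?R r")
proof -
  have S: "finite ?S" "\<And>p. p \<in> ?S \<Longrightarrow> is_interior p" by (auto simp: interior_iff_pt)
  show ?thesis
  proof
    assume "tropically_spanned ?S (pt r)"
    then obtain s where s: "pt r = pt s"
      "\<And>i j B. (\<And>x. pt x \<in> ?S \<Longrightarrow> x $ i - x $ j \<le> B) \<Longrightarrow> s $ i - s $ j \<le> B"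
      by (rule tropically_spannedD) (use S in auto)
    obtain t where t: "\<And>i. s $ i = t + r $ i" using s(1) by (auto simp: pt_eq_iff)
    have B: "r $ i - r $ j \<le> B"
      if "x $ i - x $ j \<le> B" "y $ i - y $ j \<le> B" "z $ i - z $ j \<le> B" for i j B
    proof -
      have "s $ i - s $ j \<le> B"
        by (rule s(2)) (use that in \<open>auto dest: pt_eq_imp_diff_eq[of _ _ i j]\<close>)
      then show ?thesis by (simp add: t)
    qed
    show "?R r"
      using B[of 1 2 "y $ 1 - y $ 2"] B[of 2 1 "z $ 2 - z $ 1"] B[of 2 3 "z $ 2 - z $ 3"]
        B[of 3 2 "x $ 3 - x $ 2"]
        B[of 1 3 "y $ 1 - y $ 3"] B[of 3 1 "x $ 3 - x $ 1"] assms by (auto simp: cyclically_ordered_def)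
  next
    assume "?R r"
    then have "\<forall>j. r $ 1 - y $ 1 \<le> r $ j - y $ j" "\<forall>j. r $ 2 - z $ 2 \<le> r $ j - z $ j" "\<forall>j. r $ 3 - x $ 3 \<le> r $ j - x $ j"
      using assms by (auto simp: forall_3 cyclically_ordered_def)
    then have ex: "\<exists>x. pt x \<in> ?S \<and> (\<forall>j. r $ i - x $ i \<le> r $ j - x $ j)" for i
      using exhaust_3[of i] by auto
    show "tropically_spanned ?S (pt r)"
      by (rule tropically_spannedI[OF S ex])
  qed
qed

section \<open>Comparison of span and hexagon\<close>

text \<open>The points and line vertices, in the order of the definition of \<open>hexagon\<close>,
  are the corners in \<open>hexagon_eq\<close>; \<open>s - t\<close> is the difference of
  coordinates 1 and 2.\<close>

lemma cyclically_ordered_hexagon: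
  assumes "cyclically_ordered x y z"
  shows "hexagon (pt x) (pt y) (pt z) = {(s, t). x $ 1 - x $ 3 \<le> s \<and> s \<le> y $ 1 - y $ 3 \<and>
    x $ 2 - x $ 3 \<le> t \<and> t \<le> z $ 2 - z $ 3 \<and> z $ 1 - z $ 2 \<le> s - t \<and> s - t \<le> y $ 1 - y $ 2}"
proof -
  define X1 X2 Y1 Y2 D1 D2 where "X1 = x $ 1 - x $ 3" "X2 = y $ 1 - y $ 3" "Y1 = x $ 2 - x $ 3" "Y2 = z $ 2 - z $ 3"
    "D1 = z $ 1 - z $ 2" "D2 = y $ 1 - y $ 2"
  note defs = this
  have "affine_coords (pt x) = (X1, Y1)" "affine_coords (pt y) = (X2, X2 - D2)"
    "affine_coords (pt z) = (Y2 + D1, Y2)"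
    "affine_coords (tneg (tcross (pt x) (pt y))) = (Y1 + D2, Y1)"
    "affine_coords (tneg (tcross (pt y) (pt z))) = (X2, Y2)"
    "affine_coords (tneg (tcross (pt z) (pt x))) = (X1, X1 - D1)"
    using assms by (auto simp: affine_coords_pt tneg_pt tcross_pt vector_3 cyclically_ordered_def defs max_def)
  then have "hexagon (pt x) (pt y) (pt z) =
      convex hull {(X1, Y1), (Y1 + D2, Y1), (X2, X2 - D2), (X2, Y2), (Y2 + D1, Y2), (X1, X1 - D1)}"
    by (simp add: hexagon_def)
  also have "\<dots> = {(s, t). X1 \<le> s \<and> s \<le> X2 \<and> Y1 \<le> t \<and> t \<le> Y2 \<and> D1 \<le> s - t \<and> s - t \<le> D2}"
    by (rule hexagon_eq) (use assms in \<open>auto simp: cyclically_ordered_def defs\<close>)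
  finally show ?thesis unfolding defs .
qed

text \<open>\<open>affine_coords\<close> is total, so interiority of spanned points has to be shown
  separately.\<close>

lemma cyclically_ordered_span_eq_hexagon:
  assumes "cyclically_ordered x y z"
  shows "{u. tropically_spanned {pt x, pt y, pt z} u} =
    {u. is_interior u \<and> affine_coords u \<in> hexagon (pt x) (pt y) (pt z)}"
proof -
  have "is_interior u" if "tropically_spanned {pt x, pt y, pt z} u" for u
    using that by (rule tropically_spannedD) (auto simp: interior_iff_pt)
  moreover have "tropically_spanned {pt x, pt y, pt z} (pt r) \<longleftrightarrow>
      affine_coords (pt r) \<in> hexagon (pt x) (pt y) (pt z)" for r
    unfolding cyclically_ordered_spanned_iff[OF assms] cyclically_ordered_hexagon[OF assms] by (auto simp: affine_coords_pt)
  ultimately show ?thesis unfolding interior_iff_pt by blast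
qed

section \<open>Relabelling the points and conclusion\<close>

lemma hexagon_rotate: "hexagon a b c = hexagon b c a"
  unfolding hexagon_def
  by (rule arg_cong[where f = "\<lambda>S. convex hull (affine_coords ` S)"]) blast

lemma hexagon_swap: "hexagon (pt y) (pt x) (pt z) = hexagon (pt x) (pt y) (pt z)"
  unfolding hexagon_def tcross_pt_commute[of y x] tcross_pt_commute[of x z] tcross_pt_commute[of z y]
  by (rule arg_cong[where f = "\<lambda>S. convex hull (affine_coords ` S)"]) blast

theorem theorem3:
  fixes a b c :: tp2
  assumes "transversal_triangle a b c"
  shows "{u. tropically_spanned {a, b, c} u} = {u. is_interior u \<and> affine_coords u \<in> hexagon a b c}
    \<and> tropically_independent {a, b, c}
    \<and> (\<forall>x y z :: real ^ 3. pt x = a \<and> pt y = b \<and> pt z = c \<longrightarrow>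
           tropically_regular (vector [x, y, z] :: real ^ 3 ^ 3))"
proof -
  obtain x y z where abc: "a = pt x" "b = pt y" "c = pt z"
    using assms by (auto simp: transversal_triangle_def interior_iff_pt)
  \<comment> \<open>These two claims are symmetric in the points, so rotations and a swap reduce all
    six cases to one. Regularity has ordered rows and is treated apart.\<close>
  let ?P = "\<lambda>a b c. {u. tropically_spanned {a, b, c} u} =
      {u. is_interior u \<and> affine_coords u \<in> hexagon a b c} \<and> tropically_independent {a, b, c}"
  have rot: "?P a b c" if "?P b c a" for a b c
  proof -
    have "{b, c, a} = {a, b, c}" by blast
    with that show ?thesis by (simp only: hexagon_rotate[of a b c])
  qed
  have swap: "?P (pt x) (pt y) (pt z)" if "?P (pt y) (pt x) (pt z)" for x y z
  proof -
    have "{pt y, pt x, pt z} = {pt x, pt y, pt z}" by blast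
    with that show ?thesis by (simp only: hexagon_swap[of y x z])
  qed
  have base: "?P (pt x) (pt y) (pt z)" if "cyclically_ordered x y z" for x y z
    using cyclically_ordered_span_eq_hexagon[OF that] cyclically_ordered_independent[OF that] by blast
  have "?P a b c"
    using transversal_triangle_cyclically_ordered[OF assms[unfolded abc]] unfolding abc
  proof (elim disjE)
    assume "cyclically_ordered x y z" then show "?P (pt x) (pt y) (pt z)" by (rule base)
  next
    assume "cyclically_ordered y z x" then show "?P (pt x) (pt y) (pt z)" by (intro rot[OF base])
  next
    assume "cyclically_ordered z x y" then show "?P (pt x) (pt y) (pt z)" by (intro rot[OF rot[OF base]])
  next
    assume "cyclically_ordered y x z" then show "?P (pt x) (pt y) (pt z)" by (intro swap[OF base])
  next
    assume "cyclically_ordered x z y" then show "?P (pt x) (pt y) (pt z)" by (intro swap[OF rot[OF base]])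
  next
    assume "cyclically_ordered z y x" then show "?P (pt x) (pt y) (pt z)" by (intro swap[OF rot[OF rot[OF base]]])
  qed
  \<comment> \<open>The representatives are arbitrary here, so the case distinction is applied to
    them afresh.\<close>
  moreover have "tropically_regular (vector [x, y, z] :: real ^ 3 ^ 3)"
    if "pt x = a" "pt y = b" "pt z = c" for x y z
    using transversal_triangle_cyclically_ordered assms that cyclically_ordered_regular by blast
  ultimately show ?thesis by blast
qed

end
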